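(* Let $(D,S)$ be a relational system on $A$ satisfying Condition 1 and let $R_1,\dots,R_M\subseteq A$ ($M\ge 2$) satisfy Condition 2 (both conditions are spelled out in the context). Let $x,y\in A$ with $xDy$. Then the following hold for the descending rule, and likewise for the ascending rule (the same rule being applied to both $x$ and $y$): (i) if $y$ is assigned to a single class $C_k$, then $x$ is assigned to a single class $C_{k'}$ with $k'\ge k$, or to a range $C_{k'}-C_{k'+1}$ with $k'\ge k$; (ii) if $y$ is assigned to a range $C_k-C_{k+1}$, then $x$ is assigned to a single class $C_{k'}$ with $k'\ge k+1$, or to a range $C_{k'}-C_{k'+1}$ with $k'\ge k$.
   Context: $A$ is the set of actions (all actions to be classified and all representative actions). $C=\{C_1,\dots,C_M\}$, $M\ge 2$, is a set of ordered classes, $C_M$ being the highest. Condition 1: $D$ and $S$ are binary relations on $A$ such that $D$ is transitive, $S$ is reflexive, and for all $x,y,z\in A$: $xDy\Rightarrow xSy$; ($xSy$ and $yDz$) $\Rightarrow xSz$; ($xDy$ and $ySz$) $\Rightarrow xSz$. ($S$ is also interpreted as "compatible with the order of the classes", i.e. $xSy$ is an argument for putting $x$ in a class at least as high as $y$; this is interpretive and imposes no further formal constraint.) Condition 2: each class $C_k$ is characterized by a nonempty finite set $R_k\subseteq A$ of representative actions such that (a) for $k=1,\dots,M-1$ and every $w\in R_k$ there is $z\in R_{k+1}$ with $zDw$; (b) for $k=1,\dots,M-1$ and every $w\in R_{k+1}$ there is $z\in R_k$ with $wDz$; (c) for all $1\le k<h\le M$ and every $w\in R_h$ there is no $z\in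 R_k$ with $zSw$. Notation: $xSR_k$ iff there is $z\in R_k$ with $xSz$; $R_kSx$ iff there is $w\in R_k$ with $wSx$. Descending assignment rule: by convention $xSR_0$ holds for all $x$. Let $k$ be the largest element of $\{0,\dots,M\}$ with $xSR_k$. If $k=M$, assign $x$ to the single class $C_M$; if $k=0$, assign $x$ to the single class $C_1$; if $0<k<M$, assign $x$ to the range $C_k-C_{k+1}$ (both classes possible). Ascending assignment rule: by convention $R_{M+1}Sx$ holds for all $x$. Let $k$ be the smallest element of $\{1,\dots,M+1\}$ with $R_kSx$. If $k=1$, assign $x$ to the single class $C_1$; if $k=M+1$, assign $x$ to the single class $C_M$; if $1<k<M+1$, assign $x$ to the range $C_{k-1}-C_k$. *)

theory Defs
  imports Main
begin

text \<open>Actions form a carrier set \<open>A\<close>; relations on \<open>A\<close> are binary predicates, and only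
  their values on \<open>A\<close> are ever constrained or used.\<close>

definition condition1 :: "'a set \<Rightarrow> ('a \<Rightarrow> 'a \<Rightarrow> bool) \<Rightarrow> ('a \<Rightarrow> 'a \<Rightarrow> bool) \<Rightarrow> bool" where
  "condition1 A D S \<longleftrightarrow>
     transp_on A D \<and> reflp_on A S \<and>
     (\<forall>x\<in>A. \<forall>y\<in>A. D x y \<longrightarrow> S x y) \<and>
     (\<forall>x\<in>A. \<forall>y\<in>A. \<forall>z\<in>A. S x y \<and> D y z \<longrightarrow> S x z) \<and>
     (\<forall>x\<in>A. \<forall>y\<in>A. \<forall>z\<in>A. D x y \<and> S y z \<longrightarrow> S x z)"

text \<open>Class \<open>C\<^sub>k\<close> is identified with its index \<open>k \<in> {1..M}\<close>, and \<open>R k\<close> is its set of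
  representative actions. Values of \<open>R\<close> outside \<open>{1..M}\<close> are irrelevant.\<close>

definition condition2 ::
  "'a set \<Rightarrow> ('a \<Rightarrow> 'a \<Rightarrow> bool) \<Rightarrow> ('a \<Rightarrow> 'a \<Rightarrow> bool) \<Rightarrow> nat \<Rightarrow> (nat \<Rightarrow> 'a set) \<Rightarrow> bool" where
  "condition2 A D S M R \<longleftrightarrow>
     (\<forall>k\<in>{1..M}. R k \<noteq> {} \<and> finite (R k) \<and> R k \<subseteq> A) \<and>
     (\<forall>k\<in>{1..<M}. \<forall>w\<in>R k. \<exists>z\<in>R (k + 1). D z w) \<and>
     (\<forall>k\<in>{1..<M}. \<forall>w\<in>R (k + 1). \<exists>z\<in>R k. D w z) \<and>
     (\<forall>k h. 1 \<le> k \<and> k < h \<and> h \<le> M \<longrightarrow> (\<forall>w\<in>R h. \<not> (\<exists>z\<in>R k. S z w)))"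

definition rel_set :: "('a \<Rightarrow> 'a \<Rightarrow> bool) \<Rightarrow> 'a \<Rightarrow> 'a set \<Rightarrow> bool" where
  "rel_set S x B \<longleftrightarrow> (\<exists>z\<in>B. S x z)"

definition set_rel :: "('a \<Rightarrow> 'a \<Rightarrow> bool) \<Rightarrow> 'a set \<Rightarrow> 'a \<Rightarrow> bool" where
  "set_rel S B x \<longleftrightarrow> (\<exists>w\<in>B. S w x)"

text \<open>\<open>Class_Range l h\<close> is the range from \<open>C\<^sub>l\<close> to \<open>C\<^sub>h\<close>.\<close>

datatype assignment = Single_Class nat | Class_Range nat nat

text \<open>The disjuncts \<open>k = 0\<close> and \<open>k = M + 1\<close> implement the conventions that \<open>x S R\<^sub>0\<close> and
  \<open>R\<^bsub>M+1\<^esub> S x\<close> always hold; they also make the sets below nonempty.\<close>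

definition desc_index :: "('a \<Rightarrow> 'a \<Rightarrow> bool) \<Rightarrow> nat \<Rightarrow> (nat \<Rightarrow> 'a set) \<Rightarrow> 'a \<Rightarrow> nat" where
  "desc_index S M R x = Max {k \<in> {0..M}. k = 0 \<or> rel_set S x (R k)}"

definition descending :: "('a \<Rightarrow> 'a \<Rightarrow> bool) \<Rightarrow> nat \<Rightarrow> (nat \<Rightarrow> 'a set) \<Rightarrow> 'a \<Rightarrow> assignment" where
  "descending S M R x =
     (let k = desc_index S M R x in
      if k = M then Single_Class M
      else if k = 0 then Single_Class 1
      else Class_Range k (k + 1))"

definition asc_index :: "('a \<Rightarrow> 'a \<Rightarrow> bool) \<Rightarrow> nat \<Rightarrow> (nat \<Rightarrow> 'a set) \<Rightarrow> 'a \<Rightarrow> nat" where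
  "asc_index S M R x = Min {k \<in> {1..M + 1}. k = M + 1 \<or> set_rel S (R k) x}"

definition ascending :: "('a \<Rightarrow> 'a \<Rightarrow> bool) \<Rightarrow> nat \<Rightarrow> (nat \<Rightarrow> 'a set) \<Rightarrow> 'a \<Rightarrow> assignment" where
  "ascending S M R x =
     (let k = asc_index S M R x in
      if k = 1 then Single_Class 1
      else if k = M + 1 then Single_Class M
      else Class_Range (k - 1) k)"

end

theory Submission
  imports Defs
begin

text \<open>If \<open>x D y\<close>, then \<open>y S R\<^sub>k\<close> implies \<open>x S R\<^sub>k\<close>, and \<open>R\<^sub>k S x\<close> implies \<open>R\<^sub>k S y\<close>.
  Hence neither the descending nor the ascending index of \<open>x\<close> is below that of \<open>y\<close>,
  and the assigned classes are monotone in the index.\<close>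

lemma desc_index_le: "desc_index S M R x \<le> M"
proof -
  have "desc_index S M R x \<in> {k \<in> {0..M}. k = 0 \<or> rel_set S x (R k)}"
    unfolding desc_index_def by (rule Max_in) auto
  then show ?thesis by simp
qed

lemma desc_index_mono:
  assumes "\<And>k. k \<in> {1..M} \<Longrightarrow> rel_set S y (R k) \<Longrightarrow> rel_set S x (R k)"
  shows "desc_index S M R y \<le> desc_index S M R x"
  unfolding desc_index_def
proof (rule Max_mono)
  show "{k \<in> {0..M}. k = 0 \<or> rel_set S y (R k)} \<subseteq> {k \<in> {0..M}. k = 0 \<or> rel_set S x (R k)}"
  proof
    fix k assume k: "k \<in> {k \<in> {0..M}. k = 0 \<or> rel_set S y (R k)}"
    \<comment> \<open>Index 0 lies in both sets by convention; the hypothesis speaks only of genuine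
      classes.\<close>
    show "k \<in> {k \<in> {0..M}. k = 0 \<or> rel_set S x (R k)}"
      using k assms[of k] by (cases "k = 0") auto
  qed
qed auto

lemma asc_index_bounds: "asc_index S M R x \<in> {1..M + 1}"
proof -
  have "asc_index S M R x \<in> {k \<in> {1..M + 1}. k = M + 1 \<or> set_rel S (R k) x}"
    unfolding asc_index_def by (rule Min_in) auto
  then show ?thesis by simp
qed

lemma asc_index_mono:
  assumes "\<And>k. k \<in> {1..M} \<Longrightarrow> set_rel S (R k) x \<Longrightarrow> set_rel S (R k) y"
  shows "asc_index S M R y \<le> asc_index S M R x"
  unfolding asc_index_def
proof (rule Min_antimono)
  show "{k \<in> {1..M + 1}. k = M + 1 \<or> set_rel S (R k) x}
      \<subseteq> {k \<in> {1..M + 1}. k = M + 1 \<or> set_rel S (R k) y}"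
    \<comment> \<open>\<open>le_Suc_eq\<close> separates the conventional index
      \<open>M + 1\<close>, present in both sets, from the indices up to \<open>M\<close> that
      \<open>assms\<close> covers.\<close>
    using assms by (auto simp: le_Suc_eq)
qed auto

text \<open>On \<open>A\<close>, \<open>D\<close> followed by \<open>S\<close> is contained in
  \<open>S\<close>, so a witness in \<open>B\<close> for \<open>y\<close> also serves
  \<open>x\<close>.\<close>

lemma rel_set_dominating:
  assumes "condition1 A D S" "x \<in> A" "y \<in> A" "D x y" "B \<subseteq> A" "rel_set S y B"
  shows "rel_set S x B"
  using assms unfolding condition1_def rel_set_def by blast

text \<open>The dual law: \<open>S\<close> followed by \<open>D\<close> is contained in
  \<open>S\<close>, so a witness for \<open>x\<close> also serves \<open>y\<close>.\<close>

lemma set_rel_dominated: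
  assumes "condition1 A D S" "x \<in> A" "y \<in> A" "D x y" "B \<subseteq> A" "set_rel S B x"
  shows "set_rel S B y"
  using assms unfolding condition1_def set_rel_def by blast

text \<open>Common form of both rules on the scale 0 to \<open>M\<close>, so that monotonicity is
  proved only once.\<close>

definition index_assignment :: "nat \<Rightarrow> nat \<Rightarrow> assignment" where
  "index_assignment M i =
     (if i = M then Single_Class M
      else if i = 0 then Single_Class 1
      else Class_Range i (i + 1))"

lemma descending_eq: "descending S M R x = index_assignment M (desc_index S M R x)"
  by (simp add: descending_def index_assignment_def Let_def)

text \<open>The shift by one sends 1 to 0 and \<open>M + 1\<close> to \<open>M\<close>. The rules
  test the two extremes in opposite orders, which is harmless because these differ when
  \<open>M \<ge> 1\<close>.\<close>

lemma ascending_eq: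
  assumes "M \<ge> 1"
  shows "ascending S M R x = index_assignment M (asc_index S M R x - 1)"
proof -
  have "1 \<le> asc_index S M R x" "asc_index S M R x \<le> M + 1"
    using asc_index_bounds[of S M R x] by auto
  then show ?thesis
    using assms by (auto simp: ascending_def index_assignment_def Let_def)
qed

lemma index_assignment_cases:
  assumes "i \<le> M" "M \<ge> 1"
  obtains "i = 0" "index_assignment M i = Single_Class 1"
  | "i = M" "index_assignment M i = Single_Class M"
  | "1 \<le> i" "i < M" "index_assignment M i = Class_Range i (i + 1)"
proof -
  consider "i = 0" | "i = M" | "1 \<le> i" "i < M"
    using \<open>i \<le> M\<close> by linarith
  then show ?thesis
    by cases (use that \<open>M \<ge> 1\<close> in \<open>simp_all add: index_assignment_def\<close>)
qed

lemma index_assignment_mono_Single: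
  assumes "i \<le> j" "j \<le> M" "M \<ge> 1" "index_assignment M i = Single_Class k"
  shows "(\<exists>k'\<in>{1..M}. k' \<ge> k \<and> index_assignment M j = Single_Class k') \<or>
         (\<exists>k'\<in>{1..<M}. k' \<ge> k \<and> index_assignment M j = Class_Range k' (k' + 1))"
proof -
  \<comment> \<open>A single class comes only from an extreme index: 0 gives the lowest class, a
    trivial bound, while \<open>i = M\<close> forces \<open>j = M\<close>.\<close>
  have "k = 1 \<or> k = M \<and> j = M"
    using assms by (auto simp: index_assignment_def split: if_splits)
  with \<open>j \<le> M\<close> \<open>M \<ge> 1\<close> show ?thesis
    by (cases rule: index_assignment_cases[OF \<open>j \<le> M\<close> \<open>M \<ge> 1\<close>]) auto
qed

text \<open>A range comes only from \<open>0 < i < M\<close>, with \<open>k = i\<close>. Hence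
  \<open>j\<close> is not 0, and a single class for \<open>j\<close> can only be \<open>M\<close>,
  which is at least \<open>k + 1\<close>.\<close>

lemma index_assignment_mono_Range:
  assumes "i \<le> j" "j \<le> M" "M \<ge> 1" "index_assignment M i = Class_Range k (k + 1)"
  shows "(\<exists>k'\<in>{1..M}. k' \<ge> k + 1 \<and> index_assignment M j = Single_Class k') \<or>
         (\<exists>k'\<in>{1..<M}. k' \<ge> k \<and> index_assignment M j = Class_Range k' (k' + 1))"
proof -
  have "k = i" "1 \<le> i" "i < M"
    using assms by (auto simp: index_assignment_def split: if_splits)
  with \<open>i \<le> j\<close> show ?thesis
    by (cases rule: index_assignment_cases[OF \<open>j \<le> M\<close> \<open>M \<ge> 1\<close>]) auto
qed

theorem proposition4:
  fixes A :: "'a set" and D S :: "'a \<Rightarrow> 'a \<Rightarrow> bool"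
    and M :: nat and R :: "nat \<Rightarrow> 'a set" and x y :: 'a
  assumes "condition1 A D S"
    and "M \<ge> 2"
    and "condition2 A D S M R"
    and "x \<in> A" and "y \<in> A" and "D x y"
  shows "\<forall>rule \<in> {descending S M R, ascending S M R}.
      (\<forall>k. rule y = Single_Class k \<longrightarrow>
         (\<exists>k'\<in>{1..M}. k' \<ge> k \<and> rule x = Single_Class k') \<or>
         (\<exists>k'\<in>{1..<M}. k' \<ge> k \<and> rule x = Class_Range k' (k' + 1))) \<and>
      (\<forall>k. rule y = Class_Range k (k + 1) \<longrightarrow>
         (\<exists>k'\<in>{1..M}. k' \<ge> k + 1 \<and> rule x = Single_Class k') \<or>
         (\<exists>k'\<in>{1..<M}. k' \<ge> k \<and> rule x = Class_Range k' (k' + 1)))"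
proof -
  have R: "R k \<subseteq> A" if "k \<in> {1..M}" for k
    using assms(3) that unfolding condition2_def by blast
  have desc: "desc_index S M R y \<le> desc_index S M R x"
    by (rule desc_index_mono) (use rel_set_dominating[OF assms(1,4,5,6) R] in blast)
  have asc: "asc_index S M R y \<le> asc_index S M R x"
    by (rule asc_index_mono) (use set_rel_dominated[OF assms(1,4,5,6) R] in blast)
  have asc': "asc_index S M R y - 1 \<le> asc_index S M R x - 1" "asc_index S M R x - 1 \<le> M"
    using asc asc_index_bounds[of S M R x] by auto
  have M: "M \<ge> 1" using \<open>M \<ge> 2\<close> by simp
  show ?thesis
    \<comment> \<open>The quantifier over the two rules becomes a conjunction ending in
      \<open>True\<close>, leaving four goals: single class and range for each rule.\<close>
    unfolding ball_simps
    by (intro conjI TrueI allI impI; unfold descending_eq ascending_eq[OF M])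
      (erule index_assignment_mono_Single[OF desc desc_index_le M]
        index_assignment_mono_Range[OF desc desc_index_le M]
        index_assignment_mono_Single[OF asc' M] index_assignment_mono_Range[OF asc' M])+
qed

end
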